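(* For each integer $n \ge 1$, let $$J_n = \int_{(0,1)^n} \frac{\prod_{i=1}^n x_i^{1/n}}{\frac{1}{n} \sum_{i=1}^n \sin^2(\pi x_i)} \, \mathrm{d}x_1 \cdots \mathrm{d}x_n.$$ Then $$\lim_{n\to\infty} J_n = \frac{2}{e}.$$
   Context: The integrals are Lebesgue integrals of positive measurable functions over the open unit cube $(0,1)^n$, with values in $[0,\infty]$. *)

theory Defs
  imports "HOL-Analysis.Analysis"
begin

(* Points of R^n are functions on {1..n}, with n-dimensional Lebesgue measure given by the
   product measure.  The integral takes values in [0, infinity] (it is infinite for n = 1, 2).
   On the open cube the denominator is positive for n >= 1; J 0 is a junk value. *)
definition J :: "nat \<Rightarrow> ennreal" where
  "J n = (\<integral>\<^sup>+ x \<in> (\<Pi>\<^sub>E i\<in>{1..n}. {0<..<1::real}).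
            ennreal ((\<Prod>i=1..n. x i powr (1 / real n)) /
                     (1 / real n * (\<Sum>i=1..n. (sin (pi * x i))\<^sup>2)))
          \<partial>(\<Pi>\<^sub>M i\<in>{1..n}. lborel))"

end

theory Submission imports Defs begin

text \<open>
  Write \<open>N\<close> for the numerator \<open>(x\<^sub>1 \<dots> x\<^sub>n) powr (1 / n)\<close> and \<open>S\<close> for the denominator, the
  mean of the \<open>(sin (pi * x\<^sub>i))\<^sup>2\<close>.  On the cube with its uniform probability, \<open>S\<close> concentrates
  around \<open>1 / 2\<close>, so \<open>N / S\<close> should be close to \<open>2 * N\<close> in the mean, and the integral of
  \<open>2 * N\<close> factorises: it is \<open>2 / (1 + 1 / n) ^ n\<close>, which tends to \<open>2 / e\<close>.

  The only difficulty is that \<open>1 / S\<close> is unbounded near the vertices of the cube.  Since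
  \<open>0 \<le> N \<le> 1\<close>,
    \<open>\<bar>N / S - 2 * N\<bar> \<le> \<bar>1 - 2 * S\<bar> / S \<le> \<epsilon> / S\<^sup>2 + (1 - 2 * S)\<^sup>2 / \<epsilon>\<close>  for every \<open>\<epsilon> > 0\<close>,
  so two second moments suffice.

  The integral of \<open>(1 - 2 * S)\<^sup>2\<close> is at most \<open>1 / n\<close>: indeed \<open>1 - 2 * S\<close> is the mean of the
  mutually orthogonal functions \<open>cos (2 * pi * x\<^sub>i)\<close> (\<open>nn_integral_deviation_mean_sin2\<close>).

  The integral of \<open>1 / S\<^sup>2\<close> is bounded independently of \<open>n\<close>: by the inequality between the
  arithmetic and the geometric mean, \<open>1 / S\<^sup>2\<close> is at most the product of the
  \<open>sin (pi * x\<^sub>i) powr (- 4 / n)\<close>, whose integral is the \<open>n\<close>-th power of a one-dimensional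
  integral of size \<open>1 + O(1 / n)\<close> (\<open>nn_integral_inverse_square_mean_sin2\<close>).

  With \<open>\<epsilon> = 1 / sqrt n\<close> the total error is \<open>O(1 / sqrt n)\<close> (\<open>J_error_bound\<close>).
\<close>

section \<open>Negative powers of the sine\<close>

text \<open>
  The lower bound is a product, not the sharper \<open>2 * min t (1 - t)\<close>, because negative powers of
  a product split over its two factors in \<open>nn_integral_sin_powr_neg\<close>.
\<close>
lemma sin_pi_ge:
  fixes t :: real
  assumes "0 \<le> t" "t \<le> 1"
  shows "t * (1 - t) \<le> sin (pi * t)"
proof -
  have half: "s \<le> sin (pi * s)" if "0 \<le> s" "s \<le> 1 / 2" for s :: real
  proof -
    define y where "y = pi * s"
    \<comment> \<open>For \<open>y \<le> 1.6\<close> the cubic Taylor error \<open>y ^ 3 / 6\<close> is at most \<open>y / 2\<close>, and \<open>y / 2 \<ge> s\<close>.\<close>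
    have "y \<le> pi / 2" "0 \<le> y" using that unfolding y_def by (auto simp: field_simps)
    moreover have "pi < 3.2" using pi_approx by simp
    ultimately have y: "0 \<le> y" "y \<le> 1.6" by auto
    have "sin_coeff 0 = 0" "sin_coeff (Suc 0) = 1" "sin_coeff 2 = 0"
      by (auto simp: sin_coeff_def)
    then have "\<bar>sin y - y\<bar> \<le> inverse (fact 3) * \<bar>y\<bar> ^ 3"
      using Maclaurin_sin_bound[of y 3] by (simp add: eval_nat_numeral)
    then have "\<bar>sin y - y\<bar> \<le> y * y\<^sup>2 / 6"
      using y by (simp add: fact_numeral power3_eq_cube power2_eq_square field_simps)
    then have "sin y \<ge> y - y * y\<^sup>2 / 6" by linarith
    moreover have "y * y\<^sup>2 \<le> y * 3"
    proof (rule mult_left_mono)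
      have "y\<^sup>2 \<le> 1.6\<^sup>2" using y by (intro power_mono) auto
      then show "y\<^sup>2 \<le> 3" by (simp add: power2_eq_square)
    qed (use y in auto)
    moreover have "2 * s \<le> y"
      unfolding y_def using that pi_gt3 by (intro mult_right_mono) auto
    ultimately show ?thesis unfolding y_def by linarith
  qed
  show ?thesis
  proof (cases "t \<le> 1 / 2")
    case True
    have "t * (1 - t) \<le> t * 1" using assms by (intro mult_left_mono) auto
    with half[of t] True assms show ?thesis by simp
  next
    case False
    have "t * (1 - t) \<le> 1 * (1 - t)" using assms by (intro mult_right_mono) auto
    also have "\<dots> \<le> sin (pi * (1 - t))" using half[of "1 - t"] False assms by simp
    also have "\<dots> = sin (pi * t)" by (simp add: algebra_simps sin_diff)
    finally show ?thesis .
  qed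
qed

lemma has_integral_indicator_UNIV:
  fixes f :: "real \<Rightarrow> real"
  assumes "(f has_integral I) S"
  shows "((\<lambda>t. indicator S t * f t) has_integral I) UNIV"
  using assms by (simp add: indicator_times_eq_if has_integral_restrict_UNIV if_distrib cong: if_cong)

lemma nn_integral_powr_unit_interval:
  fixes a :: real
  assumes "a > -1"
  shows "(\<integral>\<^sup>+ t\<in>{0<..<1}. ennreal (t powr a) \<partial>lborel) = ennreal (1 / (a + 1))"
proof -
  have "((\<lambda>t. t powr a) has_integral 1 / (a + 1)) {0<..<1}"
    using has_integral_powr_from_0[OF assms, of 1] by (simp add: has_integral_Icc_iff_Ioo)
  then have "((\<lambda>t. indicator {0<..<1} t * t powr a) has_integral 1 / (a + 1)) UNIV"
    by (rule has_integral_indicator_UNIV)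
  then have "(\<integral>\<^sup>+ t. ennreal (indicator {0<..<1} t * t powr a) \<partial>lborel) = ennreal (1 / (a + 1))"
    by (intro nn_integral_has_integral_lborel) auto
  then show ?thesis
    by (simp add: ennreal_mult' ennreal_indicator mult.commute)
qed

lemma nn_integral_powr_unit_interval_reflected:
  fixes a :: real
  assumes "a > -1"
  shows "(\<integral>\<^sup>+ t\<in>{0<..<1}. ennreal ((1 - t) powr a) \<partial>lborel) = ennreal (1 / (a + 1))"
proof -
  have *: "indicator {0<..<1} (1 - t) = (indicator {0<..<1} t :: ennreal)" for t :: real
    by (auto simp: indicator_def)
  have "(\<integral>\<^sup>+ t\<in>{0<..<1}. ennreal (t powr a) \<partial>lborel) =
        (\<integral>\<^sup>+ t\<in>{0<..<1}. ennreal ((1 - t) powr a) \<partial>lborel)"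
    by (subst nn_integral_real_affine[where c = "-1" and t = 1]) (simp_all add: *)
  with nn_integral_powr_unit_interval[OF assms] show ?thesis by simp
qed

text \<open>
  The factors \<open>t powr - a\<close> and \<open>(1 - t) powr - a\<close> are separated by \<open>u * v \<le> (u\<^sup>2 + v\<^sup>2) / 2\<close>.  Since
  the two weights add up to \<open>1\<close>, the bound tends to \<open>1\<close> as \<open>a\<close> tends to \<open>0\<close>; with any larger
  constant, the \<open>n\<close>-th power of the bound at \<open>a = 4 / n\<close> would be unbounded.
\<close>
lemma nn_integral_sin_powr_neg:
  fixes a :: real
  assumes "0 \<le> a" "2 * a < 1"
  shows "(\<integral>\<^sup>+ t\<in>{0<..<1}. ennreal (sin (pi * t) powr - a) \<partial>lborel) \<le> ennreal (1 / (1 - 2 * a))"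
proof -
  have *: "ennreal (sin (pi * t) powr - a) \<le>
      ennreal (1 / 2) * ennreal (t powr (- 2 * a)) + ennreal (1 / 2) * ennreal ((1 - t) powr (- 2 * a))"
    if t: "t \<in> {0<..<1}" for t :: real
  proof -
    have "sin (pi * t) powr - a \<le> (t * (1 - t)) powr - a"
      using t assms sin_pi_ge[of t] by (intro powr_mono2') auto
    also have "\<dots> = t powr - a * (1 - t) powr - a"
      using t by (simp add: powr_mult)
    also have "\<dots> \<le> 1 / 2 * (t powr - a)\<^sup>2 + 1 / 2 * ((1 - t) powr - a)\<^sup>2"
      using sum_squares_bound[of "t powr - a" "(1 - t) powr - a"] by simp
    finally have "sin (pi * t) powr - a \<le> 1 / 2 * t powr (- 2 * a) + 1 / 2 * (1 - t) powr (- 2 * a)"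
      by (simp add: power2_eq_square powr_add[symmetric])
    then have "ennreal (sin (pi * t) powr - a) \<le>
        ennreal (1 / 2 * t powr (- 2 * a) + 1 / 2 * (1 - t) powr (- 2 * a))"
      by (rule ennreal_leI)
    also have "\<dots> = ennreal (1 / 2) * ennreal (t powr (- 2 * a)) + ennreal (1 / 2) * ennreal ((1 - t) powr (- 2 * a))"
      using ennreal_mult'[of "1 / 2"] by (subst ennreal_plus) (simp_all only: powr_ge_zero mult_nonneg_nonneg zero_le_divide_1_iff zero_le_numeral)
    finally show ?thesis .
  qed
  have "(\<integral>\<^sup>+ t\<in>{0<..<1}. ennreal (sin (pi * t) powr - a) \<partial>lborel) \<le>
        (\<integral>\<^sup>+ t. ennreal (1 / 2) * (ennreal (t powr (- 2 * a)) * indicator {0<..<1} t) +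
              ennreal (1 / 2) * (ennreal ((1 - t) powr (- 2 * a)) * indicator {0<..<1} t) \<partial>lborel)"
    by (intro nn_integral_mono) (use * in \<open>simp add: indicator_def\<close>)
  also have "\<dots> = ennreal (1 / 2) * ennreal (1 / (1 - 2 * a)) + ennreal (1 / 2) * ennreal (1 / (1 - 2 * a))"
    using nn_integral_powr_unit_interval[of "- 2 * a"]
      nn_integral_powr_unit_interval_reflected[of "- 2 * a"] assms
    by (subst nn_integral_add) (auto simp: nn_integral_cmult)
  also have "\<dots> = ennreal (1 / (1 - 2 * a))"
  proof -
    have "ennreal (1 / 2) + ennreal (1 / 2) = 1"
      by (subst ennreal_plus[symmetric]) auto
    then show ?thesis by (metis distrib_right mult_1)
  qed
  finally show ?thesis .
qed

section \<open>Product functions on the cube\<close>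

abbreviation cube :: "nat \<Rightarrow> (nat \<Rightarrow> real) set"
  where "cube n \<equiv> \<Pi>\<^sub>E i\<in>{1..n}. {0<..<1::real}"

abbreviation lebesgue_pow :: "nat \<Rightarrow> (nat \<Rightarrow> real) measure"
  where "lebesgue_pow n \<equiv> \<Pi>\<^sub>M i\<in>{1..n}. lborel"

text \<open>Otherwise the simplifier rewrites the index set \<open>{1..n}\<close>, and facts about it no longer match.\<close>
declare One_nat_def [simp del]

interpretation lborel_product: product_sigma_finite "\<lambda>_::nat. lborel :: real measure"
  by standard

lemma cube_measurable [measurable]: "cube n \<in> sets (lebesgue_pow n)"
  by (intro sets_PiM_I_finite) auto

lemma indicator_cube:
  assumes "x \<in> space (lebesgue_pow n)"
  shows "(indicator (cube n) x :: 'a::{comm_semiring_1}) = (\<Prod>i=1..n. indicator {0<..<1} (x i))"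
proof (cases "x \<in> cube n")
  case False
  then obtain i where "i \<in> {1..n}" "x i \<notin> {0<..<1}"
    using assms by (auto simp: space_PiM PiE_iff)
  then have "(\<Prod>i=1..n. indicator {0<..<1} (x i) :: 'a) = 0"
    by (intro prod_zero bexI[of _ i]) auto
  with False show ?thesis by simp
next
  case True
  then have "x i \<in> {0<..<1}" if "i \<in> {1..n}" for i
    using that by (rule PiE_mem)
  with True show ?thesis by simp
qed

lemma nn_integral_cube_prod:
  assumes [measurable]: "f \<in> borel_measurable borel"
  shows "(\<integral>\<^sup>+ x\<in>cube n. (\<Prod>i=1..n. f (x i)) \<partial>lebesgue_pow n) =
         (\<integral>\<^sup>+ t\<in>{0<..<1}. f t \<partial>lborel) ^ n"
proof -
  have "(\<integral>\<^sup>+ x\<in>cube n. (\<Prod>i=1..n. f (x i)) \<partial>lebesgue_pow n) =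
        (\<integral>\<^sup>+ x. (\<Prod>i=1..n. f (x i) * indicator {0<..<1} (x i)) \<partial>lebesgue_pow n)"
    by (intro nn_integral_cong) (simp add: indicator_cube prod.distrib)
  also have "\<dots> = (\<Prod>i=1..n. \<integral>\<^sup>+ t\<in>{0<..<1}. f t \<partial>lborel)"
    by (rule lborel_product.product_nn_integral_prod) auto
  finally show ?thesis by simp
qed

section \<open>The second moment of the inverse denominator\<close>

definition mean_sin2 :: "nat \<Rightarrow> (nat \<Rightarrow> real) \<Rightarrow> real"
  where "mean_sin2 n x = 1 / real n * (\<Sum>i=1..n. (sin (pi * x i))\<^sup>2)"

lemma mean_sin2_measurable [measurable]: "mean_sin2 n \<in> borel_measurable (lebesgue_pow n)"
  unfolding mean_sin2_def by measurable

lemma sin_pi_pos: "0 < sin (pi * t)" if "t \<in> {0<..<1}" for t :: real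
  using that by (intro sin_gt_zero) auto

text \<open>
  The mean is at least the geometric mean \<open>P\<close> of the \<open>(sin (pi * x\<^sub>i))\<^sup>2\<close>, which turns the inverse
  square of a sum into a product, ready for Fubini.
\<close>
lemma inverse_square_mean_sin2_le:
  assumes "n \<ge> 1" "x \<in> cube n"
  shows "1 / (mean_sin2 n x)\<^sup>2 \<le> (\<Prod>i=1..n. sin (pi * x i) powr - (4 / real n))"
    and "0 < mean_sin2 n x"
proof -
  have pos: "0 < sin (pi * x i)" if "i \<in> {1..n}" for i
    using assms that by (intro sin_pi_pos) auto
  define P where "P = (\<Prod>i=1..n. (sin (pi * x i))\<^sup>2) powr (1 / real n)"
  have "P > 0" unfolding P_def using pos
    by (intro powr_gt_zero[THEN iffD2]) (auto simp: less_imp_neq[THEN not_sym])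
  have "P \<le> mean_sin2 n x"
    using arith_geom_mean[of "{1..n}" "\<lambda>i. (sin (pi * x i))\<^sup>2"] assms
    by (simp add: mean_sin2_def P_def sum_divide_distrib)
  with \<open>P > 0\<close> show "0 < mean_sin2 n x" by simp
  have "1 / (mean_sin2 n x)\<^sup>2 \<le> 1 / P\<^sup>2"
    using \<open>P > 0\<close> \<open>P \<le> mean_sin2 n x\<close> by (intro divide_left_mono power_mono) auto
  also have "P\<^sup>2 = (\<Prod>i=1..n. sin (pi * x i) powr (4 / real n))"
    unfolding P_def prod_powr_distrib prod_power_distrib
  proof (rule prod.cong[OF refl])
    fix i assume "i \<in> {1..n}"
    then have "(sin (pi * x i))\<^sup>2 = sin (pi * x i) powr 2" using pos[of i] by simp
    then show "(((sin (pi * x i))\<^sup>2) powr (1 / real n))\<^sup>2 = sin (pi * x i) powr (4 / real n)"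
      using pos[OF \<open>i \<in> {1..n}\<close>]
      by (simp add: powr_powr power2_eq_square powr_add[symmetric] del: powr_numeral)
  qed
  also have "1 / \<dots> = (\<Prod>i=1..n. sin (pi * x i) powr - (4 / real n))"
    by (simp add: powr_minus divide_inverse prod_inversef[symmetric] del: inverse_eq_divide)
  finally show "1 / (mean_sin2 n x)\<^sup>2 \<le> (\<Prod>i=1..n. sin (pi * x i) powr - (4 / real n))" .
qed

text \<open>
  The exponent \<open>a = 4 / n\<close> must satisfy \<open>2 * a < 1\<close>; the threshold \<open>n \<ge> 16\<close> leaves room for
  \<open>1 / (1 - 8 / n) \<le> 1 + 16 / n \<le> exp (16 / n)\<close>.
\<close>
lemma nn_integral_inverse_square_mean_sin2:
  assumes "n \<ge> 16"
  shows "(\<integral>\<^sup>+ x\<in>cube n. ennreal (1 / (mean_sin2 n x)\<^sup>2) \<partial>lebesgue_pow n) \<le> ennreal (exp 16)"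
proof -
  have "(\<integral>\<^sup>+ x\<in>cube n. ennreal (1 / (mean_sin2 n x)\<^sup>2) \<partial>lebesgue_pow n) \<le>
        (\<integral>\<^sup>+ x\<in>cube n. (\<Prod>i=1..n. ennreal (sin (pi * x i) powr - (4 / real n))) \<partial>lebesgue_pow n)"
    using inverse_square_mean_sin2_le(1)[of n] assms
    by (intro nn_integral_mono) (auto simp: prod_ennreal indicator_def intro!: ennreal_leI)
  also have "\<dots> = (\<integral>\<^sup>+ t\<in>{0<..<1}. ennreal (sin (pi * t) powr - (4 / real n)) \<partial>lborel) ^ n"
    by (rule nn_integral_cube_prod) measurable
  also have "\<dots> \<le> ennreal (1 / (1 - 2 * (4 / real n))) ^ n"
    using assms by (intro power_mono nn_integral_sin_powr_neg) (auto simp: field_simps)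
  also have "\<dots> \<le> ennreal (exp (16 / real n)) ^ n"
  proof (intro power_mono ennreal_leI)
    have "1 / (1 - 2 * (4 / real n)) \<le> 1 + 16 / real n"
      using assms by (simp add: field_simps)
    also have "\<dots> \<le> exp (16 / real n)" by (rule exp_ge_add_one_self)
    finally show "1 / (1 - 2 * (4 / real n)) \<le> exp (16 / real n)" .
  qed auto
  also have "\<dots> = ennreal (exp 16)"
    using assms by (simp add: ennreal_power exp_of_nat_mult[symmetric])
  finally show ?thesis .
qed

section \<open>Concentration of the denominator\<close>

lemma integral_cos_unit_interval:
  "(\<integral>t. indicator {0<..<1} t * cos (2 * pi * t) \<partial>lborel) = 0"
proof -
  have int: "integrable lborel (\<lambda>t::real. indicator {0<..<1} t * cos (2 * pi * t))"
    by (rule Bochner_Integration.integrable_bound[where f = "indicator {0<..<1}"])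
       (auto simp: indicator_def)
  have "((\<lambda>t. cos (2 * pi * t)) has_integral
          sin (2 * pi * 1) / (2 * pi) - sin (2 * pi * 0) / (2 * pi)) {0..1::real}"
    by (intro fundamental_theorem_of_calculus)
       (auto intro!: derivative_eq_intros simp: has_real_derivative_iff_has_vector_derivative[symmetric])
  then have "((\<lambda>t. cos (2 * pi * t)) has_integral 0) {0<..<1::real}"
    by (simp add: has_integral_Icc_iff_Ioo)
  then have "((\<lambda>t::real. indicator {0<..<1} t * cos (2 * pi * t)) has_integral 0) UNIV"
    by (rule has_integral_indicator_UNIV)
  then show "(\<integral>t. indicator {0<..<1} t * cos (2 * pi * t) \<partial>lborel) = 0"
    using has_integral_integral_lborel[OF int] has_integral_unique by blast
qed

text \<open>
  For \<open>i \<noteq> j\<close> the integral factorises and the factor at \<open>i\<close> is the mean of the cosine over a full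
  period, which vanishes.
\<close>
lemma integral_cos_cos_cube:
  fixes n i j :: nat
  assumes "i \<in> {1..n}" "j \<in> {1..n}"
  defines "F \<equiv> \<lambda>x. indicator (cube n) x * (cos (2 * pi * x i) * cos (2 * pi * x j))"
  shows "integrable (lebesgue_pow n) F"
    and "(\<integral>x. F x \<partial>lebesgue_pow n) \<le> (if i = j then 1 else 0)"
proof -
  \<comment> \<open>The functions \<open>h k\<close> write the integrand as a product with one factor per coordinate, also
    when \<open>i = j\<close> and both cosines belong to the same factor.\<close>
  define c where "c k m t = (if k = m then cos (2 * pi * t) else 1)" for k m :: nat and t :: real
  define h where "h k t = indicator {0<..<1} t * (c k i t * c k j t)" for k t
  have [measurable]: "c k m \<in> borel_measurable borel" for k m
    unfolding c_def by (cases "k = m") auto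
  have c_le: "\<bar>c k m t\<bar> \<le> 1" for k m t by (simp add: c_def)
  have F: "F x = (\<Prod>k=1..n. h k (x k))" if "x \<in> space (lebesgue_pow n)" for x
    using assms indicator_cube[OF that, where 'a = real]
    by (simp add: F_def h_def c_def prod.distrib prod.delta)
  have h_le: "\<bar>h k t\<bar> \<le> indicator {0<..<1} t" for k t
    using mult_mono[OF c_le[of k i t] c_le[of k j t]]
    by (auto simp: h_def abs_mult indicator_def)
  have int: "integrable lborel (h k)" for k
  proof (rule Bochner_Integration.integrable_bound)
    show "integrable lborel (indicator {0<..<1} :: real \<Rightarrow> real)" by simp
    show "h k \<in> borel_measurable lborel" unfolding h_def by measurable
  qed (use h_le in auto)
  have h_int: "\<bar>integral\<^sup>L lborel (h k)\<bar> \<le> 1" for k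
  proof -
    have "\<bar>integral\<^sup>L lborel (h k)\<bar> \<le> (\<integral>t. \<bar>h k t\<bar> \<partial>lborel)"
      by (rule integral_abs_bound)
    also have "\<dots> \<le> (\<integral>t. indicator {0<..<1::real} t \<partial>lborel)"
    proof (rule Bochner_Integration.integral_mono)
      show "integrable lborel (\<lambda>t. \<bar>h k t\<bar>)" using int by (rule integrable_abs)
      show "integrable lborel (indicator {0<..<1} :: real \<Rightarrow> real)" by simp
    qed (rule h_le)
    finally show ?thesis by simp
  qed
  have "integrable (lebesgue_pow n) (\<lambda>x. \<Prod>k=1..n. h k (x k))"
    by (rule lborel_product.product_integrable_prod) (auto intro: int)
  then show "integrable (lebesgue_pow n) F"
    using F by (subst Bochner_Integration.integrable_cong) auto
  have "(\<integral>x. F x \<partial>lebesgue_pow n) = (\<integral>x. (\<Prod>k=1..n. h k (x k)) \<partial>lebesgue_pow n)"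
    using F by (intro Bochner_Integration.integral_cong) auto
  also have "\<dots> = (\<Prod>k=1..n. integral\<^sup>L lborel (h k))"
    by (rule lborel_product.product_integral_prod) (auto intro: int)
  also have "\<dots> \<le> (if i = j then 1 else 0)"
  proof (cases "i = j")
    case True
    have "(\<Prod>k=1..n. integral\<^sup>L lborel (h k)) \<le> (\<Prod>k=1..n. \<bar>integral\<^sup>L lborel (h k)\<bar>)"
      by (metis abs_ge_self abs_prod)
    also have "\<dots> \<le> 1" using h_int by (intro prod_le_1) auto
    finally show ?thesis using True by simp
  next
    case False
    then have "integral\<^sup>L lborel (h i) = 0"
      using integral_cos_unit_interval by (simp add: h_def[abs_def] c_def)
    then have "(\<Prod>k=1..n. integral\<^sup>L lborel (h k)) = 0"
      using assms by (intro prod_zero) auto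
    then show ?thesis by (simp only: False if_False)
  qed
  finally show "(\<integral>x. F x \<partial>lebesgue_pow n) \<le> (if i = j then 1 else 0)" .
qed

text \<open>
  As \<open>1 - 2 * (sin u)\<^sup>2 = cos (2 * u)\<close>, the deviation is a mean of cosines; in its square only the
  \<open>n\<close> diagonal terms contribute, each at most \<open>1 / n\<^sup>2\<close>.
\<close>
lemma nn_integral_deviation_mean_sin2:
  assumes "n \<ge> 1"
  shows "(\<integral>\<^sup>+ x\<in>cube n. ennreal ((1 - 2 * mean_sin2 n x)\<^sup>2) \<partial>lebesgue_pow n) \<le> ennreal (1 / real n)"
proof -
  define F where "F i j x = indicator (cube n) x * (cos (2 * pi * x i) * cos (2 * pi * x j))"
    for i j :: nat and x :: "nat \<Rightarrow> real"
  have int: "integrable (lebesgue_pow n) (F i j)"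
    and bound: "(\<integral>x. F i j x \<partial>lebesgue_pow n) \<le> (if i = j then 1 else 0)"
    if "i \<in> {1..n}" "j \<in> {1..n}" for i j
    using integral_cos_cos_cube[OF that] by (simp_all add: F_def[abs_def])
  have mean: "1 - 2 * mean_sin2 n x = (\<Sum>i=1..n. cos (2 * pi * x i)) / real n" for x
  proof -
    have "cos (2 * pi * x i) = 1 - 2 * (sin (pi * x i))\<^sup>2" for i
      using cos_double_sin[of "pi * x i"] by (simp add: mult.assoc)
    then show ?thesis
      using assms by (simp add: mean_sin2_def sum_subtractf sum_distrib_left[symmetric] diff_divide_distrib)
  qed
  have eq: "(1 - 2 * mean_sin2 n x)\<^sup>2 * indicator (cube n) x =
      (\<Sum>i=1..n. \<Sum>j=1..n. F i j x) / (real n)\<^sup>2" for x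
    unfolding mean F_def
    by (simp add: power2_eq_square sum_product sum_distrib_left[symmetric])
  have "(\<integral>\<^sup>+ x\<in>cube n. ennreal ((1 - 2 * mean_sin2 n x)\<^sup>2) \<partial>lebesgue_pow n) =
        (\<integral>\<^sup>+ x. ennreal ((\<Sum>i=1..n. \<Sum>j=1..n. F i j x) / (real n)\<^sup>2) \<partial>lebesgue_pow n)"
    by (simp add: eq[symmetric] ennreal_mult' ennreal_indicator)
  also have "\<dots> = ennreal (\<integral>x. (\<Sum>i=1..n. \<Sum>j=1..n. F i j x) / (real n)\<^sup>2 \<partial>lebesgue_pow n)"
  proof (rule nn_integral_eq_integral)
    show "integrable (lebesgue_pow n) (\<lambda>x. (\<Sum>i=1..n. \<Sum>j=1..n. F i j x) / (real n)\<^sup>2)"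
      using int by (intro integrable_divide Bochner_Integration.integrable_sum) auto
  qed (simp add: eq[symmetric])
  also have "(\<integral>x. (\<Sum>i=1..n. \<Sum>j=1..n. F i j x) / (real n)\<^sup>2 \<partial>lebesgue_pow n) =
        (\<Sum>i=1..n. \<Sum>j=1..n. \<integral>x. F i j x \<partial>lebesgue_pow n) / (real n)\<^sup>2"
  proof -
    have "(\<integral>x. (\<Sum>i=1..n. \<Sum>j=1..n. F i j x) \<partial>lebesgue_pow n) =
          (\<Sum>i=1..n. \<integral>x. (\<Sum>j=1..n. F i j x) \<partial>lebesgue_pow n)"
      using int by (intro Bochner_Integration.integral_sum Bochner_Integration.integrable_sum) auto
    also have "\<dots> = (\<Sum>i=1..n. \<Sum>j=1..n. \<integral>x. F i j x \<partial>lebesgue_pow n)"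
      using int by (intro sum.cong refl Bochner_Integration.integral_sum) auto
    finally show ?thesis by simp
  qed
  also have "\<dots> \<le> (\<Sum>i=1..n. \<Sum>j=1..n. if i = j then 1 else 0) / (real n)\<^sup>2"
    using bound by (intro divide_right_mono sum_mono) auto
  also have "\<dots> = 1 / real n"
    by (simp add: power2_eq_square)
  finally show ?thesis by (simp add: ennreal_leI)
qed

section \<open>The limit\<close>

lemma nn_integral_geometric_mean:
  assumes "n \<ge> 1"
  shows "(\<integral>\<^sup>+ x\<in>cube n. ennreal (\<Prod>i=1..n. x i powr (1 / real n)) \<partial>lebesgue_pow n) =
         ennreal (1 / (1 + 1 / real n) ^ n)"
proof -
  have "(\<integral>\<^sup>+ x\<in>cube n. ennreal (\<Prod>i=1..n. x i powr (1 / real n)) \<partial>lebesgue_pow n) =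
        (\<integral>\<^sup>+ t\<in>{0<..<1}. ennreal (t powr (1 / real n)) \<partial>lborel) ^ n"
    by (subst nn_integral_cube_prod[symmetric]) (auto simp: prod_ennreal)
  also have "(\<integral>\<^sup>+ t\<in>{0<..<1}. ennreal (t powr (1 / real n)) \<partial>lborel) = ennreal (1 / (1 / real n + 1))"
    by (rule nn_integral_powr_unit_interval) (use assms in \<open>simp add: field_simps\<close>)
  finally show ?thesis
    by (simp add: ennreal_power power_divide add.commute)
qed

text \<open>
  The inequality \<open>a * b \<le> \<epsilon> * a\<^sup>2 + b\<^sup>2 / \<epsilon>\<close> for \<open>a = 1 / S\<close> and \<open>b = \<bar>1 - 2 * S\<bar>\<close>, used pointwise in place
  of the Cauchy-Schwarz inequality for integrals.
\<close>
lemma quotient_deviation_le: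
  fixes N S \<epsilon> :: real
  assumes "0 \<le> N" "N \<le> 1" "0 < S" "0 < \<epsilon>"
  shows "\<bar>N / S - 2 * N\<bar> \<le> \<epsilon> * (1 / S\<^sup>2) + 1 / \<epsilon> * (1 - 2 * S)\<^sup>2"
proof -
  have "N / S - 2 * N = N * ((1 - 2 * S) / S)"
    using assms by (simp add: field_simps)
  then have "\<bar>N / S - 2 * N\<bar> = N * \<bar>(1 - 2 * S) / S\<bar>"
    using assms by (simp add: abs_mult)
  also have "\<dots> \<le> 1 * \<bar>(1 - 2 * S) / S\<bar>"
    using assms by (intro mult_right_mono) auto
  also have "\<dots> = (sqrt \<epsilon> / S) * (\<bar>1 - 2 * S\<bar> / sqrt \<epsilon>)"
    using assms by (simp add: abs_divide)
  also have "\<dots> \<le> 2 * ((sqrt \<epsilon> / S) * (\<bar>1 - 2 * S\<bar> / sqrt \<epsilon>))"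
  proof -
    have "0 \<le> (sqrt \<epsilon> / S) * (\<bar>1 - 2 * S\<bar> / sqrt \<epsilon>)"
      using assms by (intro mult_nonneg_nonneg divide_nonneg_nonneg) auto
    then show ?thesis by linarith
  qed
  also have "\<dots> \<le> (sqrt \<epsilon> / S)\<^sup>2 + (\<bar>1 - 2 * S\<bar> / sqrt \<epsilon>)\<^sup>2"
    using sum_squares_bound[of "sqrt \<epsilon> / S" "\<bar>1 - 2 * S\<bar> / sqrt \<epsilon>"] by (simp only: mult.assoc)
  also have "\<dots> = \<epsilon> * (1 / S\<^sup>2) + 1 / \<epsilon> * (1 - 2 * S)\<^sup>2"
    using assms by (simp add: power_divide)
  finally show ?thesis .
qed

text \<open>
  The two second moments are at most \<open>exp 16\<close> and \<open>1 / n\<close>, so \<open>\<epsilon> = 1 / sqrt n\<close> gives both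
  error terms the same order.  The two bounds are separate because the integrals take values in
  \<open>[0, \<infinity>]\<close>, where a difference is truncated at \<open>0\<close>.
\<close>
lemma J_error_bound:
  assumes "n \<ge> 16"
  defines "A \<equiv> 2 / (1 + 1 / real n) ^ n" and "err \<equiv> (exp 16 + 1) / sqrt (real n)"
  shows "J n \<le> ennreal (A + err)" and "ennreal (A - err) \<le> J n"
proof -
  have n: "n \<ge> 1" using assms by simp
  define N where "N x = (\<Prod>i=1..n. x i powr (1 / real n))" for x :: "nat \<Rightarrow> real"
  define S where "S = mean_sin2 n"
  define \<epsilon> where "\<epsilon> = 1 / sqrt (real n)"
  define E where "E x = \<epsilon> * (1 / (S x)\<^sup>2) + 1 / \<epsilon> * (1 - 2 * S x)\<^sup>2" for x
  have "\<epsilon> > 0" unfolding \<epsilon>_def using n by simp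
  have [measurable]: "N \<in> borel_measurable (lebesgue_pow n)" "S \<in> borel_measurable (lebesgue_pow n)"
    unfolding N_def S_def by measurable
  have [measurable]: "E \<in> borel_measurable (lebesgue_pow n)"
    unfolding E_def by measurable
  have E0: "E x \<ge> 0" for x
    unfolding E_def using \<open>\<epsilon> > 0\<close> by simp
  have N: "0 \<le> N x" for x unfolding N_def by (intro prod_nonneg) auto
  have S: "0 < S x" if "x \<in> cube n" for x
    unfolding S_def by (rule inverse_square_mean_sin2_le(2)[OF n that])
  have bound: "\<bar>N x / S x - 2 * N x\<bar> \<le> E x" if "x \<in> cube n" for x
  proof -
    have "N x \<le> 1" unfolding N_def using that
      by (intro prod_le_1) (auto intro!: powr_le1 simp: PiE_iff less_imp_le)
    then show ?thesis
      unfolding E_def using S[OF that] N \<open>\<epsilon> > 0\<close> by (intro quotient_deviation_le) auto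
  qed
  have J: "J n = (\<integral>\<^sup>+ x\<in>cube n. ennreal (N x / S x) \<partial>lebesgue_pow n)"
    unfolding J_def N_def S_def mean_sin2_def ..
  have IN: "(\<integral>\<^sup>+ x\<in>cube n. ennreal (2 * N x) \<partial>lebesgue_pow n) = ennreal A"
  proof -
    have "(\<integral>\<^sup>+ x\<in>cube n. ennreal (2 * N x) \<partial>lebesgue_pow n) =
          2 * (\<integral>\<^sup>+ x\<in>cube n. ennreal (N x) \<partial>lebesgue_pow n)"
      by (subst nn_integral_cmult[symmetric]) (auto simp: ennreal_mult' mult.assoc)
    also have "\<dots> = ennreal A"
      unfolding N_def nn_integral_geometric_mean[OF n] A_def
      using ennreal_mult'[of 2 "1 / (1 + 1 / real n) ^ n"] by simp
    finally show ?thesis .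
  qed
  have IE: "(\<integral>\<^sup>+ x\<in>cube n. ennreal (E x) \<partial>lebesgue_pow n) \<le> ennreal err"
  proof -
    have "(\<integral>\<^sup>+ x\<in>cube n. ennreal (E x) \<partial>lebesgue_pow n) =
       (\<integral>\<^sup>+ x. ennreal \<epsilon> * (ennreal (1 / (S x)\<^sup>2) * indicator (cube n) x) +
            ennreal (1 / \<epsilon>) * (ennreal ((1 - 2 * S x)\<^sup>2) * indicator (cube n) x) \<partial>lebesgue_pow n)"
      using \<open>\<epsilon> > 0\<close> unfolding E_def
      by (intro nn_integral_cong) (auto simp: indicator_def ennreal_mult'[symmetric] ennreal_plus[symmetric] simp del: ennreal_plus)
    also have "\<dots> = ennreal \<epsilon> * (\<integral>\<^sup>+ x\<in>cube n. ennreal (1 / (S x)\<^sup>2) \<partial>lebesgue_pow n) +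
            ennreal (1 / \<epsilon>) * (\<integral>\<^sup>+ x\<in>cube n. ennreal ((1 - 2 * S x)\<^sup>2) \<partial>lebesgue_pow n)"
      by (subst nn_integral_add) (auto simp: nn_integral_cmult)
    also have "\<dots> \<le> ennreal \<epsilon> * ennreal (exp 16) + ennreal (1 / \<epsilon>) * ennreal (1 / real n)"
      unfolding S_def
      by (intro add_mono mult_left_mono nn_integral_inverse_square_mean_sin2
                nn_integral_deviation_mean_sin2 assms n) auto
    also have "\<dots> = ennreal (\<epsilon> * exp 16 + 1 / \<epsilon> * (1 / real n))"
      using \<open>\<epsilon> > 0\<close> by (simp add: ennreal_mult'[symmetric] ennreal_plus[symmetric] del: ennreal_plus)
    also have "\<epsilon> * exp 16 + 1 / \<epsilon> * (1 / real n) = err"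
      unfolding \<epsilon>_def err_def using n real_sqrt_mult_self[of "real n"] by (simp add: field_simps)
    finally show ?thesis .
  qed
  have A0: "A \<ge> 0" and err0: "err \<ge> 0" unfolding A_def err_def by (auto intro!: divide_nonneg_nonneg add_nonneg_nonneg)
  \<comment> \<open>Used with \<open>f, g\<close> being \<open>N / S, 2 * N\<close> in either order.\<close>
  have le_add: "(\<integral>\<^sup>+ x\<in>cube n. ennreal (f x) \<partial>lebesgue_pow n) \<le>
      (\<integral>\<^sup>+ x\<in>cube n. ennreal (g x) \<partial>lebesgue_pow n) + ennreal err"
    if [measurable]: "g \<in> borel_measurable (lebesgue_pow n)"
      and le: "\<And>x. x \<in> cube n \<Longrightarrow> f x \<le> g x + E x \<and> 0 \<le> g x" for f g
  proof -
    have "(\<integral>\<^sup>+ x\<in>cube n. ennreal (f x) \<partial>lebesgue_pow n) \<le>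
        (\<integral>\<^sup>+ x. ennreal (g x) * indicator (cube n) x + ennreal (E x) * indicator (cube n) x
          \<partial>lebesgue_pow n)"
    proof (rule nn_integral_mono)
      fix x
      show "ennreal (f x) * indicator (cube n) x \<le>
          ennreal (g x) * indicator (cube n) x + ennreal (E x) * indicator (cube n) x"
      proof (cases "x \<in> cube n")
        case True
        then have "ennreal (f x) \<le> ennreal (g x + E x)" using le by (intro ennreal_leI) auto
        also have "\<dots> = ennreal (g x) + ennreal (E x)" using le True E0 by (intro ennreal_plus) auto
        finally show ?thesis using True by simp
      qed simp
    qed
    also have "\<dots> \<le> (\<integral>\<^sup>+ x\<in>cube n. ennreal (g x) \<partial>lebesgue_pow n) + ennreal err"
      using IE by (subst nn_integral_add) (auto intro: add_left_mono)
    finally show ?thesis .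
  qed
  have "J n \<le> ennreal A + ennreal err"
    unfolding J IN[symmetric] using bound N by (intro le_add) (auto simp: abs_le_iff algebra_simps)
  then show "J n \<le> ennreal (A + err)" using A0 err0 by simp
  have "ennreal A \<le> J n + ennreal err"
    unfolding J IN[symmetric]
  proof (intro le_add)
    fix x assume x: "x \<in> cube n"
    then show "2 * N x \<le> N x / S x + E x \<and> 0 \<le> N x / S x"
      using bound[OF x] N[of x] S[OF x] by (simp add: abs_le_iff)
  qed measurable
  then show "ennreal (A - err) \<le> J n"
    using err0 by (simp add: ennreal_minus[symmetric] ennreal_minus_le_iff add.commute)
qed

theorem mainTheorem4: "J \<longlonglongrightarrow> ennreal (2 / exp 1)"
proof (rule tendsto_sandwich)
  let ?A = "\<lambda>n. 2 / (1 + 1 / real n) ^ n" and ?err = "\<lambda>n. (exp 16 + 1) / sqrt (real n)"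
  have A: "?A \<longlonglongrightarrow> 2 / exp 1"
    by (intro tendsto_divide tendsto_const tendsto_exp_limit_sequentially) simp
  have err: "?err \<longlonglongrightarrow> 0"
    by (intro tendsto_divide_0[OF tendsto_const] filterlim_at_top_imp_at_infinity
          filterlim_compose[OF sqrt_at_top filterlim_real_sequentially])
  show "(\<lambda>n. ennreal (?A n - ?err n)) \<longlonglongrightarrow> ennreal (2 / exp 1)"
    using tendsto_diff[OF A err] by (intro tendsto_ennrealI) simp
  show "(\<lambda>n. ennreal (?A n + ?err n)) \<longlonglongrightarrow> ennreal (2 / exp 1)"
    using tendsto_add[OF A err] by (intro tendsto_ennrealI) simp
  show "\<forall>\<^sub>F n in sequentially. ennreal (?A n - ?err n) \<le> J n"
    using eventually_ge_at_top[of 16] by eventually_elim (rule J_error_bound(2))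
  show "\<forall>\<^sub>F n in sequentially. J n \<le> ennreal (?A n + ?err n)"
    using eventually_ge_at_top[of 16] by eventually_elim (rule J_error_bound(1))
qed

end
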